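(* For all positive integers $k$ and $\ell$, $$\iota(P_{4\ell}\times C_{2k+1})=\ell(k+1).$$
   Context: $P_n$ and $C_n$ denote the path and the cycle on $n$ vertices. The direct product $G\times H$ has vertex set $V(G)\times V(H)$, and $(g,h)$, $(g',h')$ are adjacent if and only if $gg'\in E(G)$ and $hh'\in E(H)$. A set $S\subseteq V(G)$ is an isolating set of $G$ if $V(G)-N_G[S]$ induces a graph with no edges, where $N_G[S]$ is the closed neighborhood of $S$; $\iota(G)$ is the minimum cardinality of an isolating set of $G$. *)

theory Defs
  imports "Graph_Theory.Digraph_Component"
begin

(* A finite simple graph is a pair_graph: finite, loop-free, with a symmetric arc relation. *)

definition path_graph :: "nat \<Rightarrow> nat pair_pre_digraph" where
  "path_graph n =
     \<lparr> pverts = {..<n},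
       parcs = {(i, j). i < n \<and> j < n \<and> (j = i + 1 \<or> i = j + 1)} \<rparr>"

(* Only a simple graph for n >= 3: there is a loop for n = 1 and a single edge for n = 2. *)
definition cycle_graph :: "nat \<Rightarrow> nat pair_pre_digraph" where
  "cycle_graph n =
     \<lparr> pverts = {..<n},
       parcs = {(i, j). i < n \<and> j < n \<and> (j = (i + 1) mod n \<or> i = (j + 1) mod n)} \<rparr>"

definition direct_product ::
  "'a pair_pre_digraph \<Rightarrow> 'b pair_pre_digraph \<Rightarrow> ('a \<times> 'b) pair_pre_digraph" where
  "direct_product G H =
     \<lparr> pverts = pverts G \<times> pverts H,
       parcs = {((g, h), (g', h')). (g, g') \<in> parcs G \<and> (h, h') \<in> parcs H} \<rparr>"

definition closed_neighborhood :: "'a pair_pre_digraph \<Rightarrow> 'a set \<Rightarrow> 'a set" where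
  "closed_neighborhood G S = S \<union> {v. \<exists>u\<in>S. (u, v) \<in> parcs G}"

definition isolating_set :: "'a pair_pre_digraph \<Rightarrow> 'a set \<Rightarrow> bool" where
  "isolating_set G S \<longleftrightarrow>
     S \<subseteq> pverts G \<and>
     arcs (with_proj G \<restriction> (pverts G - closed_neighborhood G S)) = {}"

(* Meaningful for finite graphs; on an infinite vertex set card S may be 0 for infinite S. *)
definition isolation_number :: "'a pair_pre_digraph \<Rightarrow> nat" where
  "isolation_number G = (LEAST n. \<exists>S. isolating_set G S \<and> card S = n)"

lemma pair_graph_path_graph: "pair_graph (path_graph n)"
proof
  show "finite (parcs (path_graph n))"
    by (rule finite_subset[of _ "{..<n} \<times> {..<n}"]) (auto simp: path_graph_def)
qed (auto simp: path_graph_def symmetric_def sym_def)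

lemma pair_graph_cycle_graph:
  assumes "n \<ge> 3"
  shows "pair_graph (cycle_graph n)"
proof
  show "finite (parcs (cycle_graph n))"
    by (rule finite_subset[of _ "{..<n} \<times> {..<n}"]) (auto simp: cycle_graph_def)
  have "Suc i mod n \<noteq> i" if "i < n" for i
    using assms that by (cases "Suc i = n") auto
  then show "fst e \<noteq> snd e" if "e \<in> parcs (cycle_graph n)" for e
    using that by (fastforce simp: cycle_graph_def)
qed (auto simp: cycle_graph_def symmetric_def sym_def)

lemma pair_graph_direct_product:
  assumes "pair_graph G" "pair_graph H"
  shows "pair_graph (direct_product G H)"
proof -
  interpret G: pair_graph G by fact
  interpret H: pair_graph H by fact
  show ?thesis
  proof
    show "finite (pverts (direct_product G H))"
      using G.pair_finite_verts H.pair_finite_verts by (simp add: direct_product_def)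
    have "parcs (direct_product G H) \<subseteq> (pverts G \<times> pverts H) \<times> (pverts G \<times> pverts H)"
      by (auto simp: direct_product_def dest: G.wellformed' H.wellformed')
    then show "finite (parcs (direct_product G H))"
      by (rule finite_subset) (simp add: G.pair_finite_verts H.pair_finite_verts)
    show "fst e \<noteq> snd e" if "e \<in> parcs (direct_product G H)" for e
      using that G.pair_no_loops by (fastforce simp: direct_product_def)
    show "symmetric (direct_product G H)"
      using arcs_ends_symmetric[OF G.pair_sym_arcs] arcs_ends_symmetric[OF H.pair_sym_arcs]
      by (auto simp: direct_product_def symmetric_def sym_def)
  qed (auto simp: direct_product_def dest: G.wellformed' H.wellformed')
qed

lemma isolating_set_iff:
  "isolating_set G S \<longleftrightarrow>
     S \<subseteq> pverts G \<and>
     (\<forall>(u, v)\<in>parcs G.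
        u \<in> pverts G - closed_neighborhood G S \<longrightarrow> v \<notin> pverts G - closed_neighborhood G S)"
  by (fastforce simp: isolating_set_def induce_subgraph_def)

end

theory Submission
  imports Defs
begin

text \<open>
  In a product of the path on \<open>4l\<close> vertices with a graph \<open>H\<close>, call \<open>{i} \<times> V(H)\<close> the row of index
  \<open>i\<close>, for \<open>i = 0, \<dots>, 4l - 1\<close>.  Cut the rows into \<open>l\<close> blocks of four consecutive ones.
  Both bounds are found one block at a time, for a graph \<open>H\<close> more general than an odd cycle.

  Lower bound (\<open>card_isolating_set_ge\<close>), for \<open>H\<close> regular of degree \<open>d\<close>.  The edges between the two
  middle rows of a block correspond to the arcs \<open>(x, y)\<close> of \<open>H\<close>, so there are \<open>d |V(H)|\<close> of them,
  and each must have an end in the closed neighborhood of the isolating set.  Only vertices of the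
  same block reach the middle rows, and each of them takes care of just \<open>d\<^sup>2\<close> edges.  Hence every
  block contains at least \<open>|V(H)| / d\<close> vertices of the set.  For the cycle on \<open>2k + 1\<close> vertices
  this is \<open>k + 1/2\<close>, hence \<open>k + 1\<close> by integrality.

  Upper bound (\<open>ex_isolating_set_card_le\<close>), for \<open>H\<close> with a total dominating set \<open>T\<close>.  A copy of \<open>T\<close>
  in the second row of every block dominates the first and third rows of all blocks, that is, all
  rows of even index.  As every edge of the product meets such a row, this set is isolating.  An odd
  cycle on \<open>2k + 1\<close> vertices has a total dominating set of size \<open>k + 1\<close>
  (\<open>odd_cycle_total_dominating_set\<close>).
\<close>

section \<open>Isolating sets of products of a path with a regular graph\<close>

text \<open>
  The arc \<open>(x, y)\<close> of \<open>H\<close> stands for the edge joining \<open>(4t + 1, x)\<close> and \<open>(4t + 2, y)\<close>.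
  A vertex \<open>(i, z)\<close> of the block has an end of this edge in its closed neighborhood precisely
  if \<open>z\<close> is adjacent to \<open>x\<close> (for even \<open>i\<close>) or to \<open>y\<close> (for odd \<open>i\<close>): a vertex of a middle row that is
  itself an end of the edge is adjacent to the other end, so this case adds nothing.  The two kinds
  of arc sets arise from walks of length two starting at \<open>z\<close>, of which there are \<open>d\<^sup>2\<close>.
\<close>

lemma regular_card_le_block:
  assumes "pair_graph H"
    and reg: "\<And>x. x \<in> pverts H \<Longrightarrow> card (parcs H `` {x}) = d"
    and "d > 0"
    and iso: "isolating_set (direct_product (path_graph (4 * l)) H) S"
    and "t < l"
  shows "card (pverts H) \<le> d * card {v \<in> S. fst v div 4 = t}"
proof -
  interpret pair_graph H by fact
  let ?A = "parcs H"
  define B where "B = {v \<in> S. fst v div 4 = t}"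
  define cover where "cover v =
    (if even (fst v) then {(x, y) \<in> ?A. (snd v, x) \<in> ?A} else {(x, y) \<in> ?A. (snd v, y) \<in> ?A})"
    for v :: "nat \<times> 'a"
  have sym: "(y, x) \<in> ?A" if "(x, y) \<in> ?A" for x y
    using that arcs_ends_symmetric[OF pair_sym_arcs] by (auto simp: symmetric_def sym_def)
  have S_sub: "S \<subseteq> {..<4 * l} \<times> pverts H"
    using iso by (simp add: isolating_set_def direct_product_def path_graph_def)
  have fin: "finite B"
    by (rule finite_subset[of _ "{..<4 * l} \<times> pverts H"]) (use S_sub in \<open>auto simp: B_def\<close>)
  have fin_nbrs: "finite (?A `` {x})" for x
    by (rule finite_subset[OF _ pair_finite_verts]) (auto dest: wellformed')
  have card_A: "card ?A = card (pverts H) * d"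
  proof -
    have "?A = Sigma (pverts H) (\<lambda>x. ?A `` {x})"
      by (auto dest: wellformed')
    also have "card \<dots> = (\<Sum>x\<in>pverts H. card (?A `` {x}))"
      by (rule card_SigmaI) (auto simp: fin_nbrs)
    finally show ?thesis
      by (simp add: reg)
  qed
  have card_cover: "card (cover v) = d * d" if "v \<in> B" for v
  proof -
    have z: "snd v \<in> pverts H"
      using that S_sub by (auto simp: B_def)
    let ?W = "Sigma (?A `` {snd v}) (\<lambda>x. ?A `` {x})"
    have "card ?W = (\<Sum>x\<in>?A `` {snd v}. card (?A `` {x}))"
      by (rule card_SigmaI) (auto simp: fin_nbrs)
    also have "\<dots> = (\<Sum>x\<in>?A `` {snd v}. d)"
      by (rule sum.cong) (auto intro!: reg dest: wellformed')
    finally have card_W: "card ?W = d * d"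
      using z by (simp add: reg)
    show ?thesis
    proof (cases "even (fst v)")
      case True
      then have "cover v = ?W"
        by (auto simp: cover_def)
      then show ?thesis
        using card_W by simp
    next
      case False
      then have "cover v = prod.swap ` ?W"
        by (force simp: cover_def intro: sym)
      then show ?thesis
        using card_W by (simp add: card_image)
    qed
  qed
  have "?A \<subseteq> (\<Union>v\<in>B. cover v)"
  proof clarify
    fix x y assume xy: "(x, y) \<in> ?A"
    let ?G = "direct_product (path_graph (4 * l)) H"
    let ?u = "(4 * t + 1, x)" and ?w = "(4 * t + 2, y)"
    have "(?u, ?w) \<in> parcs ?G" "?u \<in> pverts ?G" "?w \<in> pverts ?G"
      using xy \<open>t < l\<close> wellformed'[OF xy] by (auto simp: direct_product_def path_graph_def)
    then have "?u \<in> closed_neighborhood ?G S \<or> ?w \<in> closed_neighborhood ?G S"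
      using iso by (auto simp: isolating_set_iff)
    then obtain i z where v: "(i, z) \<in> S"
      and near: "(i, z) = ?u \<or> ((i, z), ?u) \<in> parcs ?G \<or> (i, z) = ?w \<or> ((i, z), ?w) \<in> parcs ?G"
      by (auto simp: closed_neighborhood_def)
    from near consider
        "i = 4 * t" "(z, x) \<in> ?A" | "i = 4 * t + 1" "z = x \<or> (z, y) \<in> ?A"
      | "i = 4 * t + 2" "z = y \<or> (z, x) \<in> ?A" | "i = 4 * t + 3" "(z, y) \<in> ?A"
      by (auto simp: direct_product_def path_graph_def)
    then have "i div 4 = t \<and> (x, y) \<in> cover (i, z)"
      by cases (use xy sym[OF xy] in \<open>auto simp: cover_def\<close>)
    with v show "(x, y) \<in> (\<Union>v\<in>B. cover v)"
      by (auto simp: B_def)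
  qed
  then have "card ?A \<le> card (\<Union>v\<in>B. cover v)"
    by (rule card_mono[rotated])
       (auto simp: fin cover_def intro: finite_subset[OF _ pair_finite_arcs])
  also have "\<dots> \<le> (\<Sum>v\<in>B. card (cover v))"
    by (rule card_UN_le[OF fin])
  also have "\<dots> = d * (d * card B)"
    by (simp add: card_cover)
  finally show ?thesis
    using \<open>d > 0\<close> by (simp add: card_A B_def mult.commute)
qed

text \<open>
  Rounding up is done inside each block, before summation: the bound on
  \<^term>\<open>card S\<close> by \<open>l |V(H)| / d\<close> could fall short by almost one vertex per block.
\<close>

lemma card_isolating_set_ge:
  assumes "pair_graph H"
    and "\<And>x. x \<in> pverts H \<Longrightarrow> card (parcs H `` {x}) = d"
    and "d > 0"
    and iso: "isolating_set (direct_product (path_graph (4 * l)) H) S"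
    and m: "d * m < card (pverts H)"
  shows "l * Suc m \<le> card S"
proof -
  interpret pair_graph H by fact
  let ?B = "\<lambda>t. {v \<in> S. fst v div 4 = t}"
  have S_sub: "S \<subseteq> {..<4 * l} \<times> pverts H"
    using iso by (simp add: isolating_set_def direct_product_def path_graph_def)
  then have fin: "finite S"
    by (rule finite_subset) simp
  have block: "Suc m \<le> card (?B t)" if "t < l" for t
  proof -
    have "d * m < d * card (?B t)"
      using m regular_card_le_block[OF assms(1-4) that] by linarith
    then show ?thesis
      by simp
  qed
  have "l * Suc m = (\<Sum>t<l. Suc m)"
    by simp
  also have "\<dots> \<le> (\<Sum>t<l. card (?B t))"
    by (rule sum_mono) (use block in auto)
  also have "\<dots> = card (\<Union>t<l. ?B t)"
    by (rule card_UN_disjoint[symmetric]) (auto simp: fin)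
  also have "\<dots> \<le> card S"
    by (rule card_mono) (auto simp: fin)
  finally show ?thesis .
qed

section \<open>Isolating sets from total dominating sets\<close>

lemma ex_isolating_set_card_le:
  assumes "T \<subseteq> pverts H" "finite T"
    and dom: "\<And>x. x \<in> pverts H \<Longrightarrow> \<exists>h\<in>T. (h, x) \<in> parcs H"
    and wf: "parcs H \<subseteq> pverts H \<times> pverts H"
  shows "\<exists>S. isolating_set (direct_product (path_graph (4 * l)) H) S \<and> card S \<le> l * card T"
proof (intro exI conjI)
  let ?G = "direct_product (path_graph (4 * l)) H"
  let ?S = "(\<lambda>(t, h). (4 * t + 1, h)) ` ({..<l} \<times> T)"
  have even_row: "(i, x) \<in> closed_neighborhood ?G ?S"
    if "even i" "i < 4 * l" "x \<in> pverts H" for i x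
  proof -
    obtain h where h: "h \<in> T" "(h, x) \<in> parcs H"
      using dom \<open>x \<in> pverts H\<close> by blast
    define t where "t = i div 4"
    have t: "t < l" "i = 4 * t \<or> i = 4 * t + 2"
      using \<open>even i\<close> \<open>i < 4 * l\<close> unfolding t_def by (simp, presburger)
    then have "((4 * t + 1, h), (i, x)) \<in> parcs ?G"
      using h by (auto simp: direct_product_def path_graph_def)
    moreover have "(4 * t + 1, h) \<in> ?S"
      using h t by (intro image_eqI[of _ _ "(t, h)"]) auto
    ultimately show ?thesis
      unfolding closed_neighborhood_def by blast
  qed
  have sub: "?S \<subseteq> pverts ?G"
    using \<open>T \<subseteq> pverts H\<close> by (auto simp: direct_product_def path_graph_def)
  have edge: "u \<in> closed_neighborhood ?G ?S \<or> v \<in> closed_neighborhood ?G ?S"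
    if "(u, v) \<in> parcs ?G" for u v
  proof -
    obtain i x j y where uv: "u = (i, x)" "v = (j, y)"
      by (metis surj_pair)
    have "even i \<or> even j" "i < 4 * l" "j < 4 * l" "x \<in> pverts H" "y \<in> pverts H"
      using that wf by (auto simp: uv direct_product_def path_graph_def)
    then show ?thesis
      using even_row uv by blast
  qed
  show "isolating_set ?G ?S"
    unfolding isolating_set_iff using sub edge by blast
  have "card ?S \<le> card ({..<l} \<times> T)"
    by (rule card_image_le) (simp add: \<open>finite T\<close>)
  then show "card ?S \<le> l * card T"
    by (simp add: card_cartesian_product)
qed

section \<open>Odd cycles\<close>

lemma cycle_graph_out_degree:
  assumes "n \<ge> 3" "x < n"
  shows "card (parcs (cycle_graph n) `` {x}) = 2"
proof -
  let ?p = "if x = 0 then n - 1 else x - 1"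
  have "parcs (cycle_graph n) `` {x} = {(x + 1) mod n, ?p}"
    using assms by (auto simp: cycle_graph_def mod_Suc split: if_splits)
  moreover have "(x + 1) mod n \<noteq> ?p"
    using assms by (auto simp: mod_Suc)
  ultimately show ?thesis
    by simp
qed

text \<open>
  Going around the odd cycle in steps of two visits all vertices, and two consecutive stops \<open>2m\<close> and
  \<open>2m + 2\<close> are the neighbors of \<open>2m + 1\<close>.  So it suffices to hit one of any two consecutive
  stops, which every second of the \<open>2k + 1\<close> stops does: these are the multiples of four.
\<close>

lemma odd_cycle_total_dominating_set:
  fixes k :: nat
  defines "n \<equiv> 2 * k + 1"
  shows "\<exists>T. T \<subseteq> pverts (cycle_graph n) \<and> finite T \<and> card T \<le> k + 1 \<and>
    (\<forall>x\<in>pverts (cycle_graph n). \<exists>h\<in>T. (h, x) \<in> parcs (cycle_graph n))"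
proof (intro exI conjI ballI)
  let ?T = "(\<lambda>i. 4 * i mod n) ` {..k}"
  show "?T \<subseteq> pverts (cycle_graph n)" "finite ?T"
    by (auto simp: cycle_graph_def n_def)
  show "card ?T \<le> k + 1"
    using card_image_le[of "{..k}"] by simp
  fix x assume "x \<in> pverts (cycle_graph n)"
  then have x: "x < n"
    by (simp add: cycle_graph_def)
  \<comment> \<open>One of \<open>x\<close> and \<open>x + n\<close> is odd.\<close>
  obtain m where m: "m \<le> 2 * k" "x = (2 * m + 1) mod n"
  proof (cases "even x")
    case True
    then have "2 * (x div 2 + k) + 1 = x + n" "x div 2 + k \<le> 2 * k"
      using x by (auto simp: n_def)
    then show ?thesis
      using x that[of "x div 2 + k"] by simp
  next
    case False
    then show ?thesis
      using x that[of "x div 2"] by (simp add: n_def)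
  qed
  have n_pos: "0 < n"
    by (simp add: n_def)
  show "\<exists>h\<in>?T. (h, x) \<in> parcs (cycle_graph n)"
  proof (cases "even m")
    case True
    then have eq: "2 * m = 4 * (m div 2)" and "m div 2 \<le> k"
      using m by auto
    have "(2 * m mod n, x) \<in> parcs (cycle_graph n)"
      using m(2) n_pos by (simp add: cycle_graph_def mod_Suc_eq)
    then show ?thesis
      using eq \<open>m div 2 \<le> k\<close> by (metis atMost_iff imageI)
  next
    case False
    then have eq: "2 * m + 2 = 4 * ((m + 1) div 2)" and "(m + 1) div 2 \<le> k"
      using m by (presburger, presburger)
    have "((2 * m + 2) mod n, x) \<in> parcs (cycle_graph n)"
      using m(2) n_pos by (simp add: cycle_graph_def mod_Suc_eq)
    then show ?thesis
      using eq \<open>(m + 1) div 2 \<le> k\<close> by (metis atMost_iff imageI)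
  qed
qed

theorem corollary3p7:
  fixes k l :: nat
  assumes "k > 0" and "l > 0"
  shows "isolation_number (direct_product (path_graph (4 * l)) (cycle_graph (2 * k + 1)))
         = l * (k + 1)"
proof -
  let ?C = "cycle_graph (2 * k + 1)"
  let ?G = "direct_product (path_graph (4 * l)) ?C"
  have C: "pair_graph ?C"
    using \<open>k > 0\<close> by (intro pair_graph_cycle_graph) simp
  have lower: "l * (k + 1) \<le> card S" if "isolating_set ?G S" for S
    using card_isolating_set_ge[OF C _ _ that, of 2 k] cycle_graph_out_degree[of "2 * k + 1"] \<open>k > 0\<close>
    by (simp add: cycle_graph_def)
  obtain T where T: "T \<subseteq> pverts ?C" "finite T" "card T \<le> k + 1"
    "\<And>x. x \<in> pverts ?C \<Longrightarrow> \<exists>h\<in>T. (h, x) \<in> parcs ?C"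
    using odd_cycle_total_dominating_set[of k] by blast
  have "parcs ?C \<subseteq> pverts ?C \<times> pverts ?C"
    by (auto simp: cycle_graph_def)
  then obtain S where S: "isolating_set ?G S" "card S \<le> l * card T"
    using ex_isolating_set_card_le[OF T(1,2,4)] by blast
  have "l * card T \<le> l * (k + 1)"
    using T(3) by (rule mult_le_mono2)
  then have "card S = l * (k + 1)"
    using S lower[OF S(1)] by linarith
  then show ?thesis
    unfolding isolation_number_def using S(1) lower by (intro Least_equality) auto
qed

end
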